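(* Let $F:\mathcal M\to\mathbb R^m$ be of class $C^1$ on a smooth Riemannian manifold $\mathcal M$, let $x\in\mathcal M$, and let $d\in T_x\mathcal M$ be a $K$-descent direction for $F$ at $x$. Assume that $F$ is lower bounded, i.e. there exists $\mathcal F\in\mathbb R^m$ with $\mathcal F\preceq_K F(y)$ for all $y\in\mathcal M$. Then there exists $t>0$ that satisfies both the Wolfe conditions $$F(R_x(td))\preceq_K F(x)+c_1t\,\varphi(\mathrm DF(x)[d])\,e,\qquad \varphi\big(\mathrm DF(R_x(td))[\mathrm DR_x(td)[d]]\big)\ge c_2\,\varphi(\mathrm DF(x)[d]),$$ and the strong Wolfe conditions $$F(R_x(td))\preceq_K F(x)+c_1t\,\varphi(\mathrm DF(x)[d])\,e,\qquad \big|\varphi\big(\mathrm DF(R_x(td))[\mathrm DR_x(td)[d]]\big)\big|\le c_2\,\big|\varphi(\mathrm DF(x)[d])\big|.$$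
   Context: $K\subset\mathbb R^m$ is a closed, convex, pointed ($K\cap(-K)=\{0\}$) cone with nonempty interior; $u\preceq_K v$ means $v-u\in K$. $K^*=\{\omega\in\mathbb R^m\mid \omega^Ty\ge 0\ \text{for all } y\in K\}$, and $C\subset K^*\setminus\{0\}$ is a compact set such that $K^*$ is the cone generated by the convex hull of $C$. $\varphi:\mathbb R^m\to\mathbb R$ is $\varphi(y)=\sup\{y^Tw\mid w\in C\}$. $e\in K$ is a fixed vector with $0<\langle\omega,e\rangle\le 1$ for all $\omega\in C$, and $0<c_1<c_2<1$ are fixed constants. $R:T\mathcal M\to\mathcal M$ is a retraction, i.e. a smooth map whose restrictions $R_x$ to $T_x\mathcal M$ satisfy $R_x(0_x)=x$ and $\mathrm DR_x(0_x)=\mathrm{id}_{T_x\mathcal M}$. $\mathrm DF(x):T_x\mathcal M\to\mathbb R^m$ is the derivative of $F$. A vector $d\in T_x\mathcal M$ is a $K$-descent direction for $F$ at $x$ if $\mathrm DF(x)[d]\in-\operatorname{int}(K)$, equivalently $\varphi(\mathrm DF(x)[d])<0$. *)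

theory Defs
  imports "HOL-Analysis.Analysis" "HOL-Library.Extended_Nat"
begin

subsection \<open>Functions of class \<open>C\<^sup>k\<close> on an open set\<close>

primrec C_nat_on :: "nat \<Rightarrow> 'a::euclidean_space set \<Rightarrow> ('a \<Rightarrow> 'b::euclidean_space) \<Rightarrow> bool" where
  "C_nat_on 0 S f \<longleftrightarrow> continuous_on S f"
| "C_nat_on (Suc n) S f \<longleftrightarrow> (\<forall>x\<in>S. f differentiable (at x)) \<and>
     (\<forall>v. C_nat_on n S (\<lambda>x. frechet_derivative f (at x) v))"

definition C_on :: "enat \<Rightarrow> 'a::euclidean_space set \<Rightarrow> ('a \<Rightarrow> 'b::euclidean_space) \<Rightarrow> bool" where
  "C_on k S f \<longleftrightarrow> (\<forall>n. enat n \<le> k \<longrightarrow> C_nat_on n S f)"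


subsection \<open>Smooth manifolds\<close>

text \<open>A chart is a domain together with a coordinate map; the values of the map outside the
  domain are irrelevant.\<close>

type_synonym ('a, 'e) chart = "'a set \<times> ('a \<Rightarrow> 'e)"

definition chart_inv :: "('a, 'e) chart \<Rightarrow> 'e \<Rightarrow> 'a" where
  "chart_inv a = inv_into (fst a) (snd a)"

definition charts_at :: "('a, 'e) chart set \<Rightarrow> 'a \<Rightarrow> ('a, 'e) chart set" where
  "charts_at A p = {a \<in> A. p \<in> fst a}"

definition smooth_manifold :: "'a topology \<Rightarrow> ('a, 'e::euclidean_space) chart set \<Rightarrow> bool" where
  "smooth_manifold M A \<longleftrightarrow>
     Hausdorff_space M \<and> second_countable M \<and> topspace M = (\<Union>a\<in>A. fst a) \<and>
     (\<forall>a\<in>A. openin M (fst a) \<and> open (snd a ` fst a) \<and>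
        homeomorphic_map (subtopology M (fst a)) (top_of_set (snd a ` fst a)) (snd a)) \<and>
     (\<forall>a\<in>A. \<forall>b\<in>A. C_on \<infinity> (snd a ` (fst a \<inter> fst b)) (snd b \<circ> chart_inv a))"

text \<open>Maps of class \<open>C\<^sup>k\<close> between manifolds given by atlases. The requirement that the
  sets \<open>W\<close> are open says exactly that \<open>f\<close> is continuous.\<close>

definition C_map ::
  "enat \<Rightarrow> ('a, 'e::euclidean_space) chart set \<Rightarrow> ('b, 'f::euclidean_space) chart set
    \<Rightarrow> ('a \<Rightarrow> 'b) \<Rightarrow> bool" where
  "C_map k A B f \<longleftrightarrow>
     f ` (\<Union>a\<in>A. fst a) \<subseteq> (\<Union>b\<in>B. fst b) \<and>
     (\<forall>a\<in>A. \<forall>b\<in>B. let W = snd a ` (fst a \<inter> f -` fst b) in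
        open W \<and> C_on k W (snd b \<circ> f \<circ> chart_inv a))"

definition euclidean_atlas :: "('e::euclidean_space, 'e) chart set" where
  "euclidean_atlas = {(UNIV, id)}"


subsection \<open>Tangent vectors\<close>

text \<open>A tangent vector at \<open>p\<close> is a family of coordinate vectors, one for each chart around \<open>p\<close>,
  that transforms by the derivatives of the coordinate changes. The value \<open>0\<close> at all other
  charts makes the representation unique. Linear operations are pointwise.\<close>

type_synonym ('a, 'e) tvec = "('a, 'e) chart \<Rightarrow> 'e"

definition tangent_space :: "('a, 'e::euclidean_space) chart set \<Rightarrow> 'a \<Rightarrow> ('a, 'e) tvec set" where
  "tangent_space A p = {\<xi>.
     (\<forall>a. a \<notin> charts_at A p \<longrightarrow> \<xi> a = 0) \<and>
     (\<forall>a\<in>charts_at A p. \<forall>b\<in>charts_at A p.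
        \<xi> b = frechet_derivative (snd b \<circ> chart_inv a) (at (snd a p)) (\<xi> a))}"

definition zero_tvec :: "('a, 'e::euclidean_space) tvec" where
  "zero_tvec = (\<lambda>_. 0)"

definition add_tvec ::
  "('a, 'e::euclidean_space) tvec \<Rightarrow> ('a, 'e) tvec \<Rightarrow> ('a, 'e) tvec" where
  "add_tvec \<xi> \<eta> = (\<lambda>a. \<xi> a + \<eta> a)"

definition scale_tvec :: "real \<Rightarrow> ('a, 'e::euclidean_space) tvec \<Rightarrow> ('a, 'e) tvec" where
  "scale_tvec t \<xi> = (\<lambda>a. t *\<^sub>R \<xi> a)"

text \<open>The tangent vector at \<open>p\<close> whose coordinates in the chart \<open>a\<close> are \<open>v\<close>.\<close>

definition tvec_of ::
  "('a, 'e::euclidean_space) chart set \<Rightarrow> 'a \<Rightarrow> ('a, 'e) chart \<Rightarrow> 'e \<Rightarrow> ('a, 'e) tvec" where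
  "tvec_of A p a v = (\<lambda>b. if b \<in> charts_at A p
     then frechet_derivative (snd b \<circ> chart_inv a) (at (snd a p)) v else 0)"

text \<open>The differential at \<open>p\<close> of a map between manifolds, computed in some chart around \<open>p\<close>;
  by the transformation rule for tangent vectors the choice of the chart is immaterial.\<close>

definition differential ::
  "('a, 'e::euclidean_space) chart set \<Rightarrow> ('b, 'f::euclidean_space) chart set
    \<Rightarrow> ('a \<Rightarrow> 'b) \<Rightarrow> 'a \<Rightarrow> ('a, 'e) tvec \<Rightarrow> ('b, 'f) tvec" where
  "differential A B f p \<xi> = (\<lambda>b. if b \<in> charts_at B (f p)
     then let a = (SOME a. a \<in> charts_at A p)
          in frechet_derivative (snd b \<circ> f \<circ> chart_inv a) (at (snd a p)) (\<xi> a)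
     else 0)"

text \<open>For a map into a Euclidean space, the tangent spaces of the target are identified with
  the target through the identity chart.\<close>

definition vector_differential ::
  "('a, 'e::euclidean_space) chart set \<Rightarrow> ('a \<Rightarrow> 'v::euclidean_space) \<Rightarrow> 'a \<Rightarrow> ('a, 'e) tvec \<Rightarrow> 'v"
  where
  "vector_differential A F p \<xi> = differential A euclidean_atlas F p \<xi> (UNIV, id)"


subsection \<open>Riemannian manifolds\<close>

definition riemannian_metric ::
  "('a, 'e::euclidean_space) chart set \<Rightarrow> ('a \<Rightarrow> ('a, 'e) tvec \<Rightarrow> ('a, 'e) tvec \<Rightarrow> real) \<Rightarrow> bool"
  where
  "riemannian_metric A g \<longleftrightarrow>
     (\<forall>p\<in>(\<Union>a\<in>A. fst a). \<forall>\<xi>\<in>tangent_space A p. \<forall>\<eta>\<in>tangent_space A p. \<forall>\<zeta>\<in>tangent_space A p.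
        g p \<xi> \<eta> = g p \<eta> \<xi> \<and>
        g p (add_tvec \<xi> \<eta>) \<zeta> = g p \<xi> \<zeta> + g p \<eta> \<zeta> \<and>
        (\<forall>s. g p (scale_tvec s \<xi>) \<eta> = s * g p \<xi> \<eta>) \<and>
        (\<xi> \<noteq> zero_tvec \<longrightarrow> g p \<xi> \<xi> > 0)) \<and>
     (\<forall>a\<in>A. \<forall>v w. C_on \<infinity> (snd a ` fst a)
        (\<lambda>z. let p = chart_inv a z in g p (tvec_of A p a v) (tvec_of A p a w)))"

definition riemannian_manifold ::
  "'a topology \<Rightarrow> ('a, 'e::euclidean_space) chart set
    \<Rightarrow> ('a \<Rightarrow> ('a, 'e) tvec \<Rightarrow> ('a, 'e) tvec \<Rightarrow> real) \<Rightarrow> bool" where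
  "riemannian_manifold M A g \<longleftrightarrow> smooth_manifold M A \<and> riemannian_metric A g"


subsection \<open>Retractions\<close>

text \<open>The atlas of the tangent bundle \<open>{(p, \<xi>). \<xi> \<in> T\<^sub>pM}\<close> induced by the atlas of \<open>M\<close>.\<close>

definition tangent_bundle_atlas ::
  "('a, 'e::euclidean_space) chart set \<Rightarrow> ('a \<times> ('a, 'e) tvec, 'e \<times> 'e) chart set" where
  "tangent_bundle_atlas A =
     (\<lambda>a. (SIGMA p:fst a. tangent_space A p, \<lambda>(p, \<xi>). (snd a p, \<xi> a))) ` A"

text \<open>The tangent space at \<open>p\<close> as a manifold, with its linear coordinate maps as charts.\<close>

definition tangent_space_atlas ::
  "('a, 'e::euclidean_space) chart set \<Rightarrow> 'a \<Rightarrow> (('a, 'e) tvec, 'e) chart set" where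
  "tangent_space_atlas A p = (\<lambda>a. (tangent_space A p, \<lambda>\<xi>. \<xi> a)) ` charts_at A p"

text \<open>The canonical identification of the vector space \<open>T\<^sub>pM\<close> with its tangent space at any of its
  points: as the charts of \<open>T\<^sub>pM\<close> are linear, \<open>\<eta>\<close> has the coordinates \<open>snd c \<eta>\<close> in the chart \<open>c\<close>.\<close>

definition tvec_lift ::
  "('a, 'e::euclidean_space) chart set \<Rightarrow> 'a \<Rightarrow> ('a, 'e) tvec \<Rightarrow> (('a, 'e) tvec, 'e) tvec" where
  "tvec_lift A p \<eta> = (\<lambda>c. if c \<in> tangent_space_atlas A p then snd c \<eta> else 0)"

text \<open>\<open>fibre_differential A R p \<xi> \<eta>\<close> is the derivative \<open>DR\<^sub>p(\<xi>)[\<eta>]\<close>, a tangent vector at \<open>R\<^sub>p(\<xi>)\<close>, of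
  the restriction \<open>R\<^sub>p\<close> of \<open>R\<close> to \<open>T\<^sub>pM\<close>.\<close>

definition fibre_differential ::
  "('a, 'e::euclidean_space) chart set \<Rightarrow> ('a \<Rightarrow> ('a, 'e) tvec \<Rightarrow> 'a)
    \<Rightarrow> 'a \<Rightarrow> ('a, 'e) tvec \<Rightarrow> ('a, 'e) tvec \<Rightarrow> ('a, 'e) tvec" where
  "fibre_differential A R p \<xi> \<eta> =
     differential (tangent_space_atlas A p) A (R p) \<xi> (tvec_lift A p \<eta>)"

definition manifold_retraction ::
  "('a, 'e::euclidean_space) chart set \<Rightarrow> ('a \<Rightarrow> ('a, 'e) tvec \<Rightarrow> 'a) \<Rightarrow> bool" where
  "manifold_retraction A R \<longleftrightarrow>
     C_map \<infinity> (tangent_bundle_atlas A) A (\<lambda>(p, \<xi>). R p \<xi>) \<and>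
     (\<forall>p\<in>(\<Union>a\<in>A. fst a). R p zero_tvec = p \<and>
        (\<forall>\<eta>\<in>tangent_space A p. fibre_differential A R p zero_tvec \<eta> = \<eta>))"


subsection \<open>Orderings by cones and the Wolfe conditions\<close>

definition cone_le :: "'v::real_vector set \<Rightarrow> 'v \<Rightarrow> 'v \<Rightarrow> bool" where
  "cone_le K u v \<longleftrightarrow> v - u \<in> K"

definition dual_cone :: "'v::real_inner set \<Rightarrow> 'v set" where
  "dual_cone K = {\<omega>. \<forall>y\<in>K. \<omega> \<bullet> y \<ge> 0}"

definition cone_phi :: "'v::real_inner set \<Rightarrow> 'v \<Rightarrow> real" where
  "cone_phi C y = (SUP w\<in>C. y \<bullet> w)"

definition K_descent_direction ::
  "('a, 'e::euclidean_space) chart set \<Rightarrow> 'v::euclidean_space set \<Rightarrow> ('a \<Rightarrow> 'v)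
    \<Rightarrow> 'a \<Rightarrow> ('a, 'e) tvec \<Rightarrow> bool" where
  "K_descent_direction A K F x d \<longleftrightarrow>
     d \<in> tangent_space A x \<and> vector_differential A F x d \<in> uminus ` interior K"

definition sufficient_decrease ::
  "('a, 'e::euclidean_space) chart set \<Rightarrow> ('a \<Rightarrow> ('a, 'e) tvec \<Rightarrow> 'a) \<Rightarrow> 'v::euclidean_space set
    \<Rightarrow> 'v set \<Rightarrow> 'v \<Rightarrow> real \<Rightarrow> ('a \<Rightarrow> 'v) \<Rightarrow> 'a \<Rightarrow> ('a, 'e) tvec \<Rightarrow> real \<Rightarrow> bool" where
  "sufficient_decrease A R K C e c1 F x d t \<longleftrightarrow>
     cone_le K (F (R x (scale_tvec t d)))
       (F x + (c1 * t * cone_phi C (vector_differential A F x d)) *\<^sub>R e)"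

text \<open>\<open>\<phi>(DF(R\<^sub>x(td))[DR\<^sub>x(td)[d]])\<close>\<close>

definition phi_slope ::
  "('a, 'e::euclidean_space) chart set \<Rightarrow> ('a \<Rightarrow> ('a, 'e) tvec \<Rightarrow> 'a) \<Rightarrow> 'v::euclidean_space set
    \<Rightarrow> ('a \<Rightarrow> 'v) \<Rightarrow> 'a \<Rightarrow> ('a, 'e) tvec \<Rightarrow> real \<Rightarrow> real" where
  "phi_slope A R C F x d t =
     cone_phi C (vector_differential A F (R x (scale_tvec t d))
       (fibre_differential A R x (scale_tvec t d) d))"

definition wolfe_conditions ::
  "('a, 'e::euclidean_space) chart set \<Rightarrow> ('a \<Rightarrow> ('a, 'e) tvec \<Rightarrow> 'a) \<Rightarrow> 'v::euclidean_space set
    \<Rightarrow> 'v set \<Rightarrow> 'v \<Rightarrow> real \<Rightarrow> real \<Rightarrow> ('a \<Rightarrow> 'v) \<Rightarrow> 'a \<Rightarrow> ('a, 'e) tvec \<Rightarrow> real \<Rightarrow> bool" where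
  "wolfe_conditions A R K C e c1 c2 F x d t \<longleftrightarrow>
     sufficient_decrease A R K C e c1 F x d t \<and>
     phi_slope A R C F x d t \<ge> c2 * cone_phi C (vector_differential A F x d)"

definition strong_wolfe_conditions ::
  "('a, 'e::euclidean_space) chart set \<Rightarrow> ('a \<Rightarrow> ('a, 'e) tvec \<Rightarrow> 'a) \<Rightarrow> 'v::euclidean_space set
    \<Rightarrow> 'v set \<Rightarrow> 'v \<Rightarrow> real \<Rightarrow> real \<Rightarrow> ('a \<Rightarrow> 'v) \<Rightarrow> 'a \<Rightarrow> ('a, 'e) tvec \<Rightarrow> real \<Rightarrow> bool" where
  "strong_wolfe_conditions A R K C e c1 c2 F x d t \<longleftrightarrow>
     sufficient_decrease A R K C e c1 F x d t \<and>
     \<bar>phi_slope A R C F x d t\<bar> \<le> c2 * \<bar>cone_phi C (vector_differential A F x d)\<bar>"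

end

theory Submission
  imports Defs
begin

text \<open>Put \<open>G t = F (R\<^sub>x(td))\<close>; by the chain rule in charts \<open>G\<close> is continuously differentiable with
  \<open>G' t = DF(R\<^sub>x(td))[DR\<^sub>x(td)[d]]\<close>. Let \<open>s = \<phi>(G' 0) < 0\<close>. If \<open>\<phi>(G' t) < c\<^sub>2 s\<close> held for all \<open>t \<ge> 0\<close>,
  then \<open>\<omega>\<^sup>T G\<close> would tend to \<open>-\<infinity>\<close> for every \<open>\<omega> \<in> C\<close>, contradicting the lower bound of \<open>F\<close>. So there is
  a first \<open>t\<close> with \<open>\<phi>(G' t) = c\<^sub>2 s\<close>, which gives both curvature conditions. Up to this \<open>t\<close> all slopes
  of \<open>\<omega>\<^sup>T G\<close> are at most \<open>c\<^sub>2 s < c\<^sub>1 s \<le> c\<^sub>1 s \<omega>\<^sup>T e\<close>; integrating, and using that \<open>C\<close> generates the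
  dual cone, gives the sufficient decrease.\<close>

subsection \<open>Functions of class \<open>C\<^sup>1\<close>\<close>

lemma C_on_imp_C1:
  assumes "C_on k S f" "1 \<le> k"
  shows "C_nat_on (Suc 0) S f"
  using assms by (metis C_on_def One_nat_def one_enat_def)

lemma C1_has_derivative:
  assumes "C_nat_on (Suc 0) S f" "y \<in> S"
  shows "(f has_derivative frechet_derivative f (at y)) (at y)"
  using assms frechet_derivative_works by auto

text \<open>\<open>C_nat_on\<close> only provides continuity of the derivative in each fixed
  direction; expanding the moving direction \<open>v t\<close> in the finite basis reduces to such
  directions.\<close>

lemma continuous_on_C1_derivative:
  fixes f :: "'a::euclidean_space \<Rightarrow> 'b::euclidean_space"
  assumes f: "C_nat_on (Suc 0) S f" and h: "continuous_on T h" "h ` T \<subseteq> S"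
    and v: "continuous_on T v"
  shows "continuous_on T (\<lambda>t. frechet_derivative f (at (h t)) (v t))"
proof -
  have "frechet_derivative f (at (h t)) (v t) =
      (\<Sum>i\<in>Basis. (v t \<bullet> i) *\<^sub>R frechet_derivative f (at (h t)) i)" if "t \<in> T" for t
  proof -
    have "linear (frechet_derivative f (at (h t)))"
      using C1_has_derivative[OF f, of "h t"] h(2) that has_derivative_linear by blast
    then have "frechet_derivative f (at (h t)) (\<Sum>i\<in>Basis. (v t \<bullet> i) *\<^sub>R i) =
        (\<Sum>i\<in>Basis. (v t \<bullet> i) *\<^sub>R frechet_derivative f (at (h t)) i)"
      by (simp add: linear_sum linear_cmul)
    then show ?thesis
      by (simp add: euclidean_representation)
  qed
  moreover have "continuous_on T (\<lambda>t. \<Sum>i\<in>Basis. (v t \<bullet> i) *\<^sub>R frechet_derivative f (at (h t)) i)"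
  proof (intro continuous_intros v)
    fix i :: 'a
    have "continuous_on S (\<lambda>y. frechet_derivative f (at y) i)"
      using f by simp
    then show "continuous_on T (\<lambda>t. frechet_derivative f (at (h t)) i)"
      by (rule continuous_on_compose2[OF _ h])
  qed
  ultimately show ?thesis
    by (simp cong: continuous_on_cong)
qed

subsection \<open>The tangent bundle in charts\<close>

definition bundle_chart ::
  "('a, 'e::euclidean_space) chart set \<Rightarrow> ('a, 'e) chart
    \<Rightarrow> ('a \<times> ('a, 'e) tvec, 'e \<times> 'e) chart" where
  "bundle_chart A a = (SIGMA p:fst a. tangent_space A p, \<lambda>(p, \<xi>). (snd a p, \<xi> a))"

lemma tangent_bundle_atlas_eq: "tangent_bundle_atlas A = bundle_chart A ` A"
  by (simp add: tangent_bundle_atlas_def bundle_chart_def)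

lemma tangent_space_transform:
  assumes "\<xi> \<in> tangent_space A p" "a \<in> charts_at A p" "b \<in> charts_at A p"
  shows "\<xi> b = frechet_derivative (snd b \<circ> chart_inv a) (at (snd a p)) (\<xi> a)"
  using assms unfolding tangent_space_def by blast

lemma tangent_space_outside: "\<xi> \<in> tangent_space A p \<Longrightarrow> a \<notin> charts_at A p \<Longrightarrow> \<xi> a = 0"
  unfolding tangent_space_def by blast

text \<open>One component determines those at all charts around \<open>p\<close> by the
  transformation rule, and the remaining components are 0.\<close>

lemma tangent_space_eqI:
  assumes "\<xi> \<in> tangent_space A p" "\<eta> \<in> tangent_space A p" "a \<in> charts_at A p" "\<xi> a = \<eta> a"
  shows "\<xi> = \<eta>"
proof
  fix b
  show "\<xi> b = \<eta> b"
    using assms tangent_space_transform tangent_space_outside by metis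
qed

lemma chart_inj_on:
  assumes "smooth_manifold M A" "a \<in> A"
  shows "inj_on (snd a) (fst a)"
proof -
  have "homeomorphic_map (subtopology M (fst a)) (top_of_set (snd a ` fst a)) (snd a)"
    "openin M (fst a)"
    using assms by (auto simp: smooth_manifold_def)
  then show ?thesis
    by (metis homeomorphic_imp_injective_map openin_subset topspace_subtopology_subset)
qed

text \<open>The base point is recovered because \<open>snd a\<close> is injective on
  \<open>fst a\<close>, then the vector from its component at \<open>a\<close>. As
  \<open>chart_inv\<close> is an \<open>inv_into\<close>, this makes it a left inverse of the bundle
  chart.\<close>

lemma bundle_chart_inj_on:
  assumes "smooth_manifold M A" "a \<in> A"
  shows "inj_on (snd (bundle_chart A a)) (fst (bundle_chart A a))"
proof (rule inj_onI)
  fix z w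
  assume z: "z \<in> fst (bundle_chart A a)" and w: "w \<in> fst (bundle_chart A a)"
    and eq: "snd (bundle_chart A a) z = snd (bundle_chart A a) w"
  obtain p \<xi> where z': "z = (p, \<xi>)" "p \<in> fst a" "\<xi> \<in> tangent_space A p"
    using z by (auto simp: bundle_chart_def)
  obtain q \<eta> where w': "w = (q, \<eta>)" "q \<in> fst a" "\<eta> \<in> tangent_space A q"
    using w by (auto simp: bundle_chart_def)
  have "snd a p = snd a q" and c: "\<xi> a = \<eta> a"
    using eq z' w' by (auto simp: bundle_chart_def)
  then have "p = q"
    using chart_inj_on[OF assms] z' w' by (auto dest: inj_onD)
  moreover have "\<xi> = \<eta>"
    using tangent_space_eqI[of \<xi> A p \<eta> a] z' w' c \<open>p = q\<close> assms(2) by (auto simp: charts_at_def)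
  ultimately show "z = w"
    by (simp only: z' w')
qed

text \<open>Coordinate changes are smooth, so their \<open>frechet_derivative\<close> is a true
  derivative and hence linear; the transformation rule therefore commutes with scaling.\<close>

lemma scale_tvec_in_tangent_space:
  assumes M: "smooth_manifold M A" and \<xi>: "\<xi> \<in> tangent_space A p"
  shows "scale_tvec t \<xi> \<in> tangent_space A p"
proof -
  have "t *\<^sub>R \<xi> b = frechet_derivative (snd b \<circ> chart_inv a) (at (snd a p)) (t *\<^sub>R \<xi> a)"
    if ab: "a \<in> charts_at A p" "b \<in> charts_at A p" for a b
  proof -
    have "C_on \<infinity> (snd a ` (fst a \<inter> fst b)) (snd b \<circ> chart_inv a)"
      using M ab by (simp add: smooth_manifold_def charts_at_def)
    then have "C_nat_on (Suc 0) (snd a ` (fst a \<inter> fst b)) (snd b \<circ> chart_inv a)"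
      by (rule C_on_imp_C1) simp
    moreover have "snd a p \<in> snd a ` (fst a \<inter> fst b)"
      using ab by (simp add: charts_at_def)
    ultimately have "linear (frechet_derivative (snd b \<circ> chart_inv a) (at (snd a p)))"
      by (rule C1_has_derivative[THEN has_derivative_linear])
    then show ?thesis
      by (simp only: linear_cmul tangent_space_transform[OF \<xi> ab])
  qed
  moreover have "t *\<^sub>R \<xi> a = 0" if "a \<notin> charts_at A p" for a
    using tangent_space_outside[OF \<xi> that] by simp
  ultimately show ?thesis
    unfolding tangent_space_def scale_tvec_def by blast
qed

subsection \<open>A function along a retraction curve\<close>

locale retraction_curve =
  fixes M :: "'a topology" and A :: "('a, 'e::euclidean_space) chart set"
    and R :: "'a \<Rightarrow> ('a, 'e) tvec \<Rightarrow> 'a" and F :: "'a \<Rightarrow> 'v::euclidean_space"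
    and x :: 'a and d :: "('a, 'e) tvec"
  assumes manifold: "smooth_manifold M A"
    and R_smooth: "C_map \<infinity> (tangent_bundle_atlas A) A (\<lambda>(p, \<xi>). R p \<xi>)"
    and F_C1: "C_map 1 A euclidean_atlas F"
    and x_in: "x \<in> topspace M"
    and d_in: "d \<in> tangent_space A x"
begin

definition curve :: "real \<Rightarrow> 'a" where
  "curve t = R x (scale_tvec t d)"

text \<open>The intended derivative of F along the curve, in the intrinsic form used by
  \<open>phi_slope\<close>.\<close>

definition velocity :: "real \<Rightarrow> 'v" where
  "velocity t = vector_differential A F (curve t) (fibre_differential A R x (scale_tvec t d) d)"

section \<open>Coordinate representatives of R and F\<close>

definition R_dom :: "('a, 'e) chart \<Rightarrow> ('a, 'e) chart \<Rightarrow> ('e \<times> 'e) set" where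
  "R_dom a b = snd (bundle_chart A a) `
     (fst (bundle_chart A a) \<inter> (\<lambda>(p, \<xi>). R p \<xi>) -` fst b)"

definition R_loc :: "('a, 'e) chart \<Rightarrow> ('a, 'e) chart \<Rightarrow> 'e \<times> 'e \<Rightarrow> 'e" where
  "R_loc a b = snd b \<circ> (\<lambda>(p, \<xi>). R p \<xi>) \<circ> chart_inv (bundle_chart A a)"

text \<open>The factor \<open>id\<close> is the coordinate map of \<open>euclidean_atlas\<close>, so
  this is the representative that occurs in \<open>C_map\<close> and
  \<open>differential\<close>.\<close>

definition F_loc :: "('a, 'e) chart \<Rightarrow> 'e \<Rightarrow> 'v" where
  "F_loc b = id \<circ> F \<circ> chart_inv b"

lemma R_loc_C1:
  assumes "a \<in> A" "b \<in> A"
  shows "open (R_dom a b)" "C_nat_on (Suc 0) (R_dom a b) (R_loc a b)"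
proof -
  have *: "open (R_dom a b) \<and> C_on \<infinity> (R_dom a b) (R_loc a b)"
    using R_smooth assms
    by (simp add: C_map_def tangent_bundle_atlas_eq Let_def R_dom_def R_loc_def)
  then show "open (R_dom a b)"
    by simp
  show "C_nat_on (Suc 0) (R_dom a b) (R_loc a b)"
    by (rule C_on_imp_C1[OF conjunct2[OF *]]) simp
qed

lemma F_loc_C1:
  assumes "b \<in> A"
  shows "C_nat_on (Suc 0) (snd b ` fst b) (F_loc b)"
proof -
  have "C_on 1 (snd b ` fst b) (F_loc b)"
    using F_C1 assms by (simp add: C_map_def euclidean_atlas_def Let_def F_loc_def)
  then show ?thesis
    by (rule C_on_imp_C1) simp
qed

lemma chart_inv_bundle_chart:
  assumes "a \<in> charts_at A x" "\<xi> \<in> tangent_space A x"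
  shows "chart_inv (bundle_chart A a) (snd a x, \<xi> a) = (x, \<xi>)"
proof -
  have "a \<in> A" and in_dom: "(x, \<xi>) \<in> fst (bundle_chart A a)"
    using assms by (auto simp: bundle_chart_def charts_at_def)
  have "(snd a x, \<xi> a) = snd (bundle_chart A a) (x, \<xi>)"
    by (simp add: bundle_chart_def)
  then show ?thesis
    unfolding chart_inv_def
    by (simp only: inv_into_f_f[OF bundle_chart_inj_on[OF manifold \<open>a \<in> A\<close>] in_dom])
qed

text \<open>By injectivity of the bundle chart, \<open>(x, \<xi>)\<close> is the only point of its
  domain with these coordinates. This later turns openness of \<open>R_dom\<close> into openness of
  a set of parameters t.\<close>

lemma R_dom_iff:
  assumes "a \<in> charts_at A x" "\<xi> \<in> tangent_space A x"
  shows "(snd a x, \<xi> a) \<in> R_dom a b \<longleftrightarrow> R x \<xi> \<in> fst b"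
proof
  assume "(snd a x, \<xi> a) \<in> R_dom a b"
  then obtain z where z: "z \<in> fst (bundle_chart A a)" "(\<lambda>(p, \<xi>). R p \<xi>) z \<in> fst b"
    "(snd a x, \<xi> a) = snd (bundle_chart A a) z"
    unfolding R_dom_def image_iff Int_iff vimage_eq by blast
  have "a \<in> A"
    using assms by (simp add: charts_at_def)
  then have "chart_inv (bundle_chart A a) (snd a x, \<xi> a) = z"
    unfolding chart_inv_def z(3)
    by (intro inv_into_f_f bundle_chart_inj_on[OF manifold] z(1))
  then have "z = (x, \<xi>)"
    using chart_inv_bundle_chart[OF assms] by (rule trans[OF sym])
  then show "R x \<xi> \<in> fst b"
    using z(2) by simp
next
  assume "R x \<xi> \<in> fst b"
  moreover have "(x, \<xi>) \<in> fst (bundle_chart A a)" "snd (bundle_chart A a) (x, \<xi>) = (snd a x, \<xi> a)"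
    using assms by (auto simp: bundle_chart_def charts_at_def)
  ultimately show "(snd a x, \<xi> a) \<in> R_dom a b"
    unfolding R_dom_def by (intro image_eqI[of _ _ "(x, \<xi>)"]) auto
qed

lemma R_loc_eq:
  assumes "a \<in> charts_at A x" "\<xi> \<in> tangent_space A x"
  shows "R_loc a b (snd a x, \<xi> a) = snd b (R x \<xi>)"
  using chart_inv_bundle_chart[OF assms] by (simp add: R_loc_def)

lemma R_dom_obtain:
  assumes "a \<in> charts_at A x" "(snd a x, v) \<in> R_dom a b"
  obtains \<xi> where "\<xi> \<in> tangent_space A x" "\<xi> a = v"
proof -
  obtain p \<xi> where *: "p \<in> fst a" "\<xi> \<in> tangent_space A p" "snd a p = snd a x" "\<xi> a = v"
    using assms(2) by (auto simp: R_dom_def bundle_chart_def)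
  moreover have "p = x"
    using chart_inj_on[OF manifold, of a] * assms(1) by (auto simp: charts_at_def dest: inj_onD)
  ultimately show ?thesis
    using that by simp
qed

lemma charts_at_nonempty: "p \<in> topspace M \<Longrightarrow> \<exists>a. a \<in> charts_at A p"
  using manifold by (auto simp: smooth_manifold_def charts_at_def)

lemma scale_d_in: "scale_tvec t d \<in> tangent_space A x"
  by (rule scale_tvec_in_tangent_space[OF manifold d_in])

lemma curve_in: "curve t \<in> topspace M"
proof -
  obtain a where a: "a \<in> charts_at A x"
    using charts_at_nonempty[OF x_in] by blast
  have "(x, scale_tvec t d) \<in> (\<Union>c\<in>tangent_bundle_atlas A. fst c)"
    using a scale_d_in
    by (auto simp: tangent_bundle_atlas_eq bundle_chart_def charts_at_def)
  then have "R x (scale_tvec t d) \<in> (\<Union>b\<in>A. fst b)"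
    using R_smooth unfolding C_map_def by force
  then show ?thesis
    using manifold by (simp add: smooth_manifold_def curve_def)
qed

text \<open>The openness of \<open>R_dom a b\<close> makes every coordinate vector near \<open>\<xi> a\<close> the coordinates of a
  tangent vector at \<open>x\<close>.\<close>

lemma fibre_differential_in_charts:
  assumes \<xi>: "\<xi> \<in> tangent_space A x" and b: "b \<in> charts_at A (R x \<xi>)"
  obtains a where "a \<in> charts_at A x"
    "fibre_differential A R x \<xi> \<eta> b = frechet_derivative (R_loc a b) (at (snd a x, \<xi> a)) (0, \<eta> a)"
proof -
  \<comment> \<open>\<open>differential\<close> works in a chart picked by \<open>SOME\<close>, so
    the computation must be done in exactly this chart. It is induced by some chart \<open>a\<close>
    at \<open>x\<close>, which is why the lemma obtains \<open>a\<close> instead of fixing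
    it.\<close>
  define c where "c = (SOME c. c \<in> charts_at (tangent_space_atlas A x) \<xi>)"
  have "\<exists>c. c \<in> charts_at (tangent_space_atlas A x) \<xi>"
    using charts_at_nonempty[OF x_in] \<xi> by (auto simp: charts_at_def tangent_space_atlas_def)
  then have c_in: "c \<in> charts_at (tangent_space_atlas A x) \<xi>"
    unfolding c_def by (rule someI_ex)
  then obtain a where a: "a \<in> charts_at A x" and c: "c = (tangent_space A x, \<lambda>\<xi>. \<xi> a)"
    by (auto simp: charts_at_def tangent_space_atlas_def)
  have ab: "a \<in> A" "b \<in> A" "R x \<xi> \<in> fst b"
    using a b by (auto simp: charts_at_def)
  let ?\<iota> = "\<lambda>v. (snd a x, v)"
  have in_dom: "?\<iota> (\<xi> a) \<in> R_dom a b"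
    using R_dom_iff[OF a \<xi>] ab by simp
  \<comment> \<open>Freezing the base coordinates turns the representative of R into that of its
    restriction to the fibre. The agreement holds on an open set of \<open>v\<close>, so it passes
    to derivatives.\<close>
  have eq: "R_loc a b (?\<iota> v) = (snd b \<circ> R x \<circ> chart_inv c) v" if v: "?\<iota> v \<in> R_dom a b" for v
  proof -
    obtain \<zeta> where \<zeta>: "\<zeta> \<in> tangent_space A x" "\<zeta> a = v"
      using R_dom_obtain[OF a v] by blast
    have "inj_on (\<lambda>\<xi>. \<xi> a) (tangent_space A x)"
      using a by (auto intro: inj_onI tangent_space_eqI)
    from inv_into_f_f[OF this \<zeta>(1)] have "chart_inv c v = \<zeta>"
      by (simp add: chart_inv_def c \<zeta>)
    then show ?thesis
      using R_loc_eq[OF a \<zeta>(1)] \<zeta> by simp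
  qed
  have "(R_loc a b has_derivative frechet_derivative (R_loc a b) (at (?\<iota> (\<xi> a)))) (at (?\<iota> (\<xi> a)))"
    by (rule C1_has_derivative[OF R_loc_C1(2)[OF ab(1,2)] in_dom])
  moreover have "(?\<iota> has_derivative (\<lambda>v. (0, v))) (at (\<xi> a))"
    by (auto intro!: derivative_eq_intros)
  ultimately have "((\<lambda>v. R_loc a b (?\<iota> v)) has_derivative
      (\<lambda>v. frechet_derivative (R_loc a b) (at (?\<iota> (\<xi> a))) (0, v))) (at (\<xi> a))"
    by (rule has_derivative_compose[rotated])
  moreover have "open (?\<iota> -` R_dom a b)"
    by (intro open_vimage R_loc_C1 ab continuous_intros)
  ultimately have "((snd b \<circ> R x \<circ> chart_inv c) has_derivative
      (\<lambda>v. frechet_derivative (R_loc a b) (at (?\<iota> (\<xi> a))) (0, v))) (at (\<xi> a))"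
    by (rule has_derivative_transform_within_open) (use in_dom eq in auto)
  then have "frechet_derivative (snd b \<circ> R x \<circ> chart_inv c) (at (\<xi> a)) =
      (\<lambda>v. frechet_derivative (R_loc a b) (at (?\<iota> (\<xi> a))) (0, v))"
    by (rule frechet_derivative_at[symmetric])
  moreover have "c \<in> tangent_space_atlas A x"
    using c_in by (simp add: charts_at_def)
  ultimately have "fibre_differential A R x \<xi> \<eta> b =
      frechet_derivative (R_loc a b) (at (snd a x, \<xi> a)) (0, \<eta> a)"
    using b unfolding fibre_differential_def differential_def Let_def c_def[symmetric] tvec_lift_def
    by (simp add: c)
  with a that show ?thesis
    by blast
qed

text \<open>This is the chain rule for \<open>F_loc b \<circ> R_loc a b \<circ> \<gamma>\<close>.
  The charts do not depend on t, so continuity of the derivative can be read off on all of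
  \<open>T\<close>.\<close>

lemma derivative_in_charts:
  assumes a: "a \<in> charts_at A x" and b: "b \<in> A"
  defines "\<gamma> \<equiv> \<lambda>t. (snd a x, t *\<^sub>R d a)"
  defines "D \<equiv> \<lambda>t. frechet_derivative (F_loc b) (at (snd b (curve t)))
      (frechet_derivative (R_loc a b) (at (\<gamma> t)) (0, d a))"
  defines "T \<equiv> curve -` fst b"
  shows "open T" "continuous_on T D"
    "\<And>t. t \<in> T \<Longrightarrow> ((\<lambda>t. F (curve t)) has_vector_derivative D t) (at t)"
proof -
  have aA: "a \<in> A"
    using a by (simp add: charts_at_def)
  note R1 = R_loc_C1[OF aA b] and F1 = F_loc_C1[OF b]
  have \<gamma>_cont: "continuous_on S \<gamma>" for S
    unfolding \<gamma>_def by (intro continuous_intros)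
  have \<gamma>_dom: "\<gamma> t \<in> R_dom a b \<longleftrightarrow> t \<in> T" for t
    using R_dom_iff[OF a scale_d_in[of t]] by (simp add: \<gamma>_def T_def scale_tvec_def curve_def)
  then have "T = \<gamma> -` R_dom a b"
    by blast
  then show "open T"
    using open_vimage[OF R1(1) \<gamma>_cont] by simp
  have R_curve: "R_loc a b (\<gamma> t) = snd b (curve t)" for t
    using R_loc_eq[OF a scale_d_in[of t]] by (simp add: \<gamma>_def scale_tvec_def curve_def)
  have F_curve: "F_loc b (snd b (curve t)) = F (curve t)" if "t \<in> T" for t
    using inv_into_f_f[OF chart_inj_on[OF manifold b]] that
    by (simp add: F_loc_def chart_inv_def T_def)
  have R_der: "((\<lambda>t. snd b (curve t)) has_derivative
      (\<lambda>h. h *\<^sub>R frechet_derivative (R_loc a b) (at (\<gamma> t)) (0, d a))) (at t)" if "t \<in> T" for t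
  proof -
    note der = C1_has_derivative[OF R1(2), of "\<gamma> t"]
    have "(\<gamma> has_derivative (\<lambda>h. h *\<^sub>R (0, d a))) (at t)"
      unfolding \<gamma>_def by (auto intro!: derivative_eq_intros)
    from has_derivative_compose[OF this der]
    have "((\<lambda>t. R_loc a b (\<gamma> t)) has_derivative
        (\<lambda>h. frechet_derivative (R_loc a b) (at (\<gamma> t)) (h *\<^sub>R (0, d a)))) (at t)"
      using that \<gamma>_dom by simp
    moreover have "linear (frechet_derivative (R_loc a b) (at (\<gamma> t)))"
      using der that \<gamma>_dom has_derivative_linear by blast
    ultimately show ?thesis
      by (simp only: linear_cmul R_curve)
  qed
  have "continuous_on T (\<lambda>t. snd b (curve t))"
    using R_der has_derivative_continuous by (blast intro: continuous_at_imp_continuous_on)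
  moreover have "continuous_on T (\<lambda>t. frechet_derivative (R_loc a b) (at (\<gamma> t)) (0, d a))"
    by (rule continuous_on_C1_derivative[OF R1(2) \<gamma>_cont]) (use \<gamma>_dom in auto)
  ultimately show "continuous_on T D"
    unfolding D_def by (intro continuous_on_C1_derivative[OF F1]) (auto simp: T_def)
  show "((\<lambda>t. F (curve t)) has_vector_derivative D t) (at t)" if t: "t \<in> T" for t
  proof -
    have "snd b (curve t) \<in> snd b ` fst b"
      using t by (simp add: T_def)
    note der = C1_has_derivative[OF F1 this]
    have "((\<lambda>t. F_loc b (snd b (curve t))) has_derivative (\<lambda>h. h *\<^sub>R D t)) (at t)"
      using has_derivative_compose[OF R_der[OF t] der]
      by (simp only: D_def linear_cmul[OF has_derivative_linear[OF der]])
    then have "((\<lambda>t. F (curve t)) has_derivative (\<lambda>h. h *\<^sub>R D t)) (at t)"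
      by (rule has_derivative_transform_within_open[OF _ \<open>open T\<close> t]) (simp add: F_curve)
    then show ?thesis
      by (simp add: has_vector_derivative_def)
  qed
qed

lemma has_vector_derivative_velocity:
  "((\<lambda>t. F (curve t)) has_vector_derivative velocity t) (at t)"
proof -
  \<comment> \<open>This is the chart that \<open>differential\<close> itself selects at
    \<open>curve t\<close>; with it \<open>velocity t\<close> unfolds to the expression
    \<open>D t\<close> of \<open>derivative_in_charts\<close>.\<close>
  define b where "b = (SOME b. b \<in> charts_at A (curve t))"
  have b: "b \<in> charts_at A (curve t)"
    unfolding b_def by (rule someI_ex[OF charts_at_nonempty[OF curve_in]])
  obtain a where a: "a \<in> charts_at A x"
    and eq: "fibre_differential A R x (scale_tvec t d) d b =
      frechet_derivative (R_loc a b) (at (snd a x, scale_tvec t d a)) (0, d a)"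
    using fibre_differential_in_charts[OF scale_d_in, of b t d] b by (auto simp: curve_def)
  have "velocity t = frechet_derivative (F_loc b) (at (snd b (curve t)))
      (frechet_derivative (R_loc a b) (at (snd a x, t *\<^sub>R d a)) (0, d a))"
    using eq unfolding velocity_def vector_differential_def differential_def Let_def
      b_def[symmetric] F_loc_def
    by (simp add: charts_at_def euclidean_atlas_def scale_tvec_def)
  then show ?thesis
    using derivative_in_charts(3)[OF a, of b t] b by (simp add: charts_at_def)
qed

text \<open>The charts selected inside \<open>velocity\<close> may jump with t, so its own formula
  does not show continuity. Uniqueness of derivatives identifies it, near each parameter, with the
  continuous \<open>D\<close> computed in fixed charts.\<close>

lemma continuous_on_velocity: "continuous_on S velocity"
proof (rule continuous_at_imp_continuous_on, rule ballI)
  fix t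
  obtain a b where a: "a \<in> charts_at A x" and b: "b \<in> charts_at A (curve t)"
    using charts_at_nonempty x_in curve_in by meson
  then have bA: "b \<in> A" and t: "t \<in> curve -` fst b"
    by (auto simp: charts_at_def)
  note loc = derivative_in_charts[OF a bA]
  have "continuous_on (curve -` fst b) velocity"
    using vector_derivative_unique_at[OF has_vector_derivative_velocity loc(3)]
    by (intro iffD2[OF continuous_on_cong[OF refl] loc(2)])
  then show "isCont velocity t"
    using loc(1) t continuous_on_eq_continuous_at by blast
qed

end

subsection \<open>The scalarization \<open>\<phi>\<close>\<close>

lemma inner_le_cone_phi:
  assumes "compact C" "w \<in> C"
  shows "y \<bullet> w \<le> cone_phi C y"
  unfolding cone_phi_def
proof (rule cSUP_upper[OF assms(2)])
  have "compact ((\<lambda>w. y \<bullet> w) ` C)"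
    by (intro compact_continuous_image assms continuous_intros)
  then show "bdd_above ((\<lambda>w. y \<bullet> w) ` C)"
    by (simp add: bounded_imp_bdd_above compact_imp_bounded)
qed

lemma cone_phi_attained:
  fixes C :: "'v::real_inner set"
  assumes "compact C" "C \<noteq> {}"
  obtains w where "w \<in> C" "cone_phi C y = y \<bullet> w"
proof -
  have "continuous_on C (\<lambda>w. y \<bullet> w)"
    by (intro continuous_intros)
  then obtain w where w: "w \<in> C" "\<forall>v\<in>C. y \<bullet> v \<le> y \<bullet> w"
    using continuous_attains_sup assms by metis
  have "cone_phi C y = y \<bullet> w"
  proof (rule antisym)
    show "cone_phi C y \<le> y \<bullet> w"
      unfolding cone_phi_def by (rule cSUP_least) (use w assms in auto)
  qed (use inner_le_cone_phi assms w in auto)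
  with w that show ?thesis
    by blast
qed

text \<open>A maximum of linear functionals of norm at most \<open>B\<close> is
  \<open>B\<close>-Lipschitz: the maximizer for \<open>y\<close> bounds the value at
  \<open>z\<close> from below.\<close>

lemma continuous_on_cone_phi:
  fixes C :: "'v::real_inner set"
  assumes "compact C" "C \<noteq> {}"
  shows "continuous_on S (cone_phi C)"
proof -
  obtain B where B: "B > 0" "\<And>w. w \<in> C \<Longrightarrow> norm w \<le> B"
    using compact_imp_bounded[OF assms(1)] bounded_pos by metis
  have le: "cone_phi C y - cone_phi C z \<le> B * dist y z" for y z
  proof -
    obtain w where w: "w \<in> C" "cone_phi C y = y \<bullet> w"
      using cone_phi_attained[OF assms] by blast
    have "cone_phi C y - cone_phi C z \<le> (y - z) \<bullet> w"
      using inner_le_cone_phi[OF assms(1) w(1), of z] w(2) by (simp add: inner_diff_left)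
    also have "\<dots> \<le> norm (y - z) * norm w"
      by (rule norm_cauchy_schwarz)
    also have "\<dots> \<le> norm (y - z) * B"
      using B w by (simp add: mult_left_mono)
    finally show ?thesis
      by (simp add: dist_norm mult.commute)
  qed
  have "B-lipschitz_on S (cone_phi C)"
  proof (rule lipschitz_onI)
    fix y z
    show "dist (cone_phi C y) (cone_phi C z) \<le> B * dist y z"
      using le[of y z] le[of z y] by (simp add: dist_real_def dist_commute)
  qed (use B in simp)
  then show ?thesis
    by (rule lipschitz_on_continuous_on)
qed

text \<open>Every nonzero element of the dual cone is strictly positive on the interior of
  \<open>K\<close>. Strictness survives the supremum because it is attained.\<close>

lemma cone_phi_neg:
  fixes K C :: "'v::euclidean_space set"
  assumes C: "C \<subseteq> dual_cone K - {0}" "compact C" "C \<noteq> {}" and y: "y \<in> uminus ` interior K"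
  shows "cone_phi C y < 0"
proof -
  obtain w where w: "w \<in> C" "cone_phi C y = y \<bullet> w"
    using cone_phi_attained[OF C(2,3)] by blast
  have w': "w \<noteq> 0" "\<And>k. k \<in> K \<Longrightarrow> 0 \<le> w \<bullet> k"
    using C(1) w(1) by (auto simp: dual_cone_def)
  obtain k where k: "y = - k" "k \<in> interior K"
    using y by blast
  obtain \<epsilon> where \<epsilon>: "\<epsilon> > 0" "cball k \<epsilon> \<subseteq> K"
    using k(2) mem_interior_cball by blast
  \<comment> \<open>Going from \<open>k\<close> a distance \<open>\<epsilon>\<close> against
    \<open>w\<close> reaches the point of the ball where \<open>w\<close> is smallest; it still lies
    in \<open>K\<close>.\<close>
  define k' where "k' = k - (\<epsilon> / norm w) *\<^sub>R w"
  have "k' \<in> cball k \<epsilon>"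
    using \<epsilon> w' by (simp add: k'_def dist_norm)
  then have "0 \<le> w \<bullet> k'"
    using \<epsilon> w' by blast
  then have "(\<epsilon> / norm w) * (w \<bullet> w) \<le> w \<bullet> k"
    by (simp add: k'_def inner_diff_right)
  moreover have "(\<epsilon> / norm w) * (w \<bullet> w) > 0"
    using \<epsilon> w' by simp
  ultimately show ?thesis
    using w k by (simp add: inner_commute)
qed

text \<open>This is the bipolar theorem: a hyperplane separating \<open>y\<close> from
  \<open>K\<close> has its normal in the dual cone, hence in the cone generated by \<open>C\<close>,
  where nonnegativity on \<open>y\<close> is inherited from \<open>C\<close>.\<close>

lemma mem_cone_if_generators_nonneg:
  fixes K C :: "'v::euclidean_space set"
  assumes K: "closed K" "convex K" "cone K" "K \<noteq> {}"
    and C: "dual_cone K = cone hull (convex hull C)" and y: "\<And>w. w \<in> C \<Longrightarrow> 0 \<le> w \<bullet> y"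
  shows "y \<in> K"
proof (rule ccontr)
  assume "y \<notin> K"
  then obtain a \<beta> where a: "a \<bullet> y < \<beta>" "\<And>k. k \<in> K \<Longrightarrow> \<beta> < a \<bullet> k"
    using separating_hyperplane_closed_point[OF K(2,1)] by blast
  have "0 \<in> K"
    using K cone_contains_0 by blast
  then have "\<beta> < 0"
    using a(2) by fastforce
  have "0 \<le> a \<bullet> k" if "k \<in> K" for k
  proof (rule ccontr)
    assume neg: "\<not> 0 \<le> a \<bullet> k"
    \<comment> \<open>The factor is positive as a quotient of two negative numbers, and it moves
      \<open>k\<close> onto the hyperplane of level \<open>\<beta>\<close>, which \<open>K\<close>
      strictly avoids.\<close>
    have "(\<beta> / (a \<bullet> k)) *\<^sub>R k \<in> K"
      using K(3) that neg \<open>\<beta> < 0\<close> by (simp add: cone_def divide_nonpos_nonpos)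
    from a(2)[OF this] neg show False
      by simp
  qed
  then have "a \<in> cone hull (convex hull C)"
    unfolding C[symmetric] by (simp add: dual_cone_def)
  then obtain r z where z: "a = r *\<^sub>R z" "0 \<le> r" "z \<in> convex hull C"
    by (auto simp: cone_hull_expl)
  have "convex hull C \<subseteq> {z. y \<bullet> z \<ge> 0}"
    using y by (intro hull_minimal convex_halfspace_ge) (auto simp: inner_commute)
  then have "0 \<le> a \<bullet> y"
    using z by (auto simp: inner_commute)
  with a(1) \<open>\<beta> < 0\<close> show False
    by simp
qed

subsection \<open>Step sizes along a curve\<close>

lemma inner_growth_le:
  fixes G :: "real \<Rightarrow> 'v::real_inner"
  assumes der: "\<And>t. (G has_vector_derivative G' t) (at t)" and "0 \<le> t"
    and le: "\<And>u. 0 \<le> u \<Longrightarrow> u \<le> t \<Longrightarrow> G' u \<bullet> w \<le> r"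
  shows "G t \<bullet> w \<le> G 0 \<bullet> w + r * t"
proof -
  have "((\<lambda>u. G u \<bullet> w - r * u) has_real_derivative G' u \<bullet> w - r) (at u)" for u
    using der[of u] unfolding has_vector_derivative_def has_field_derivative_def
    by (auto intro!: derivative_eq_intros simp: algebra_simps)
  from DERIV_nonpos_imp_nonincreasing[OF assms(2), of "\<lambda>u. G u \<bullet> w - r * u"] this le
  have "G t \<bullet> w - r * t \<le> G 0 \<bullet> w - r * 0"
    by (metis diff_le_0_iff_le)
  then show ?thesis
    by simp
qed

text \<open>The least \<open>t\<close> in \<open>{0..T}\<close> with \<open>c \<le> f t\<close>
  works: minimality keeps \<open>f\<close> below \<open>c\<close> before it, and the intermediate
  value theorem forces equality at it.\<close>

lemma exists_first_crossing:
  fixes f :: "real \<Rightarrow> real"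
  assumes cont: "continuous_on UNIV f" and "f 0 < c" and T: "0 \<le> T" "c \<le> f T"
  obtains t where "0 < t" "f t = c" "\<And>u. 0 \<le> u \<Longrightarrow> u \<le> t \<Longrightarrow> f u \<le> c"
proof -
  define S where "S = {0..T} \<inter> f -` {c..}"
  have "closed (f -` {c..})"
    using cont by (simp add: closed_vimage)
  then have "compact S"
    unfolding S_def by (simp add: compact_Int_closed)
  moreover have "S \<noteq> {}"
    using T by (auto simp: S_def)
  ultimately obtain t where t: "t \<in> S" "\<And>u. u \<in> S \<Longrightarrow> t \<le> u"
    using compact_attains_inf by metis
  have "0 \<le> t" "c \<le> f t" "t \<le> T"
    using t(1) by (auto simp: S_def)
  then obtain u where u: "0 \<le> u" "u \<le> t" "f u = c"
    using IVT'[of f 0 c t] continuous_on_subset[OF cont] \<open>f 0 < c\<close> by auto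
  \<comment> \<open>Minimality of \<open>t\<close> gives \<open>t \<le> u\<close>, so the point
    \<open>u\<close> found by the intermediate value theorem is \<open>t\<close> itself.\<close>
  then have "u \<in> S"
    using \<open>t \<le> T\<close> by (simp add: S_def)
  then have "f t = c"
    using t(2) u by force
  moreover have "0 < t"
    using \<open>f t = c\<close> \<open>f 0 < c\<close> \<open>0 \<le> t\<close> by (metis less_irrefl less_eq_real_def)
  moreover have "f u \<le> c" if "0 \<le> u" "u \<le> t" for u
  proof (rule ccontr)
    assume "\<not> f u \<le> c"
    moreover from this have "u \<in> S"
      using that \<open>t \<le> T\<close> by (simp add: S_def)
    then have "u = t"
      using t(2) that by force
    ultimately show False
      using \<open>f t = c\<close> by simp
  qed
  ultimately show ?thesis
    using that by blast
qed

text \<open>This is the manifold-free core, for a \<open>C\<^sup>1\<close> curve in Euclidean space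
  that is bounded below in the cone order.\<close>

lemma exists_wolfe_step:
  fixes G G' :: "real \<Rightarrow> 'v::euclidean_space" and K C :: "'v set"
  assumes K: "closed K" "convex K" "cone K" "K \<noteq> {}"
    and C: "C \<subseteq> dual_cone K" "compact C" "C \<noteq> {}" "dual_cone K = cone hull (convex hull C)"
    and e: "\<And>w. w \<in> C \<Longrightarrow> w \<bullet> e \<le> 1"
    and c: "0 < c1" "c1 < c2" "c2 < 1"
    and der: "\<And>t. (G has_vector_derivative G' t) (at t)" and cont: "continuous_on UNIV G'"
    and neg: "cone_phi C (G' 0) < 0"
    and B: "\<And>t. cone_le K B (G t)"
  obtains t where "0 < t" "cone_le K (G t) (G 0 + (c1 * t * cone_phi C (G' 0)) *\<^sub>R e)"
    "cone_phi C (G' t) = c2 * cone_phi C (G' 0)"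
proof -
  define s where "s = cone_phi C (G' 0)"
  have s: "s < 0"
    using neg by (simp add: s_def)
  have "\<exists>T\<ge>0. c2 * s \<le> cone_phi C (G' T)"
  proof (rule ccontr)
    assume "\<not> ?thesis"
    then have less: "cone_phi C (G' t) \<le> c2 * s" if "0 \<le> t" for t
      using that by force
    obtain w where w: "w \<in> C"
      using C by blast
    have "c2 * s < 0"
      using c s by (simp add: mult_less_0_iff)
    \<comment> \<open>\<open>T\<close> is chosen so that slope \<open>c2 * s\<close> lowers the
      \<open>w\<close>-component by one more than its initial distance to the bound
      \<open>B\<close>.\<close>
    define T where "T = (\<bar>(G 0 - B) \<bullet> w\<bar> + 1) / - (c2 * s)"
    have T: "0 \<le> T" "c2 * s * T = - (\<bar>(G 0 - B) \<bullet> w\<bar> + 1)"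
      using \<open>c2 * s < 0\<close> by (auto simp: T_def divide_nonneg_neg)
    have "G T \<bullet> w \<le> G 0 \<bullet> w + c2 * s * T"
      by (rule inner_growth_le[OF der T(1)])
        (use less inner_le_cone_phi[OF C(2) w] in \<open>blast intro: order_trans\<close>)
    moreover have "B \<bullet> w \<le> G T \<bullet> w"
      using B[of T] C(1) w
      by (force simp: cone_le_def dual_cone_def inner_diff_right inner_commute[of _ w])
    ultimately show False
      using T(2) by (simp add: inner_diff_left)
  qed
  then obtain T where T: "0 \<le> T" "c2 * s \<le> cone_phi C (G' T)"
    by blast
  have "continuous_on UNIV (\<lambda>t. cone_phi C (G' t))"
    by (rule continuous_on_compose2[OF continuous_on_cone_phi[OF C(2,3), of UNIV] cont]) simp
  moreover have "cone_phi C (G' 0) < c2 * s"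
    using s c by (simp add: s_def[symmetric])
  ultimately obtain t where t: "0 < t" "cone_phi C (G' t) = c2 * s"
    "\<And>u. 0 \<le> u \<Longrightarrow> u \<le> t \<Longrightarrow> cone_phi C (G' u) \<le> c2 * s"
    using exists_first_crossing[of "\<lambda>t. cone_phi C (G' t)", OF _ _ T] by metis
  have "0 \<le> w \<bullet> (G 0 + (c1 * t * s) *\<^sub>R e - G t)" if w: "w \<in> C" for w
  proof -
    have "G t \<bullet> w \<le> G 0 \<bullet> w + c2 * s * t"
      by (rule inner_growth_le[OF der]) (use t inner_le_cone_phi[OF C(2) w] in \<open>auto intro: order_trans\<close>)
    also have "c2 * s * t \<le> c1 * s * t"
      using c s t by (simp add: mult_right_mono mult_right_mono_neg)
    \<comment> \<open>The factor \<open>c1 * t * s\<close> is negative, so the upper bound 1 on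
      \<open>w \<bullet> e\<close> yields a lower bound on the product.\<close>
    also have "\<dots> \<le> c1 * t * s * (w \<bullet> e)"
      using e[OF w] c s t mult_left_mono_neg[of "w \<bullet> e" 1 "c1 * t * s"]
      by (simp add: mult_nonneg_nonpos mult_ac)
    finally show ?thesis
      by (simp add: inner_diff_right inner_add_right inner_commute)
  qed
  then have "G 0 + (c1 * t * s) *\<^sub>R e - G t \<in> K"
    by (rule mem_cone_if_generators_nonneg[OF K C(4)])
  then show ?thesis
    using that t by (simp add: cone_le_def s_def)
qed

section \<open>Application to the retraction curve\<close>

theorem proposition4p2:
  fixes M :: "'a topology" and A :: "('a, 'e::euclidean_space) chart set"
    and g :: "'a \<Rightarrow> ('a, 'e) tvec \<Rightarrow> ('a, 'e) tvec \<Rightarrow> real"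
    and R :: "'a \<Rightarrow> ('a, 'e) tvec \<Rightarrow> 'a"
    and K C :: "(real ^ 'm) set" and e :: "real ^ 'm" and c1 c2 :: real
    and F :: "'a \<Rightarrow> real ^ 'm" and x :: 'a and d :: "('a, 'e) tvec"
  assumes "closed K" and "convex K" and "cone K"
    and "K \<inter> uminus ` K = {0}" and "interior K \<noteq> {}"
    and "C \<subseteq> dual_cone K - {0}" and "compact C" and "dual_cone K = cone hull (convex hull C)"
    and "e \<in> K" and "\<forall>\<omega>\<in>C. 0 < \<omega> \<bullet> e \<and> \<omega> \<bullet> e \<le> 1"
    and "0 < c1" and "c1 < c2" and "c2 < 1"
    and "riemannian_manifold M A g"
    and "manifold_retraction A R"
    and "C_map 1 A euclidean_atlas F"
    and "x \<in> topspace M"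
    and "K_descent_direction A K F x d"
    and "\<exists>B. \<forall>y\<in>topspace M. cone_le K B (F y)"
  shows "\<exists>t>0. wolfe_conditions A R K C e c1 c2 F x d t \<and>
    strong_wolfe_conditions A R K C e c1 c2 F x d t"
proof -
  have manifold: "smooth_manifold M A"
    using assms(14) by (simp add: riemannian_manifold_def)
  have d_in: "d \<in> tangent_space A x"
    and descent: "vector_differential A F x d \<in> uminus ` interior K"
    using assms(18) by (auto simp: K_descent_direction_def)
  interpret retraction_curve M A R F x d
    using assms(15-17) manifold d_in by unfold_locales (auto simp: manifold_retraction_def)
  have x_chart: "x \<in> (\<Union>a\<in>A. fst a)"
    using manifold assms(17) by (simp add: smooth_manifold_def)
  have "scale_tvec 0 d = zero_tvec"
    by (simp add: scale_tvec_def zero_tvec_def)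
  \<comment> \<open>Both retraction identities enter here: the zero vector is sent to
    \<open>x\<close>, and the fibre differential at it fixes \<open>d\<close>.\<close>
  then have zero: "curve 0 = x" "velocity 0 = vector_differential A F x d"
    using assms(15) x_chart d_in
    unfolding manifold_retraction_def curve_def velocity_def by metis+
  have "0 \<in> dual_cone K"
    by (simp add: dual_cone_def)
  \<comment> \<open>An empty \<open>C\<close> would generate the empty set, but the dual cone
    contains 0.\<close>
  then have "C \<noteq> {}"
    using assms(8) cone_hull_empty_iff[of "{} :: (real ^ 'm) set"] by auto
  obtain B where B: "\<forall>y\<in>topspace M. cone_le K B (F y)"
    using assms(19) by blast
  have neg: "cone_phi C (velocity 0) < 0"
    unfolding zero by (rule cone_phi_neg[OF assms(6,7) \<open>C \<noteq> {}\<close> descent])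
  obtain t where t: "0 < t"
    "cone_le K (F (curve t)) (F (curve 0) + (c1 * t * cone_phi C (velocity 0)) *\<^sub>R e)"
    "cone_phi C (velocity t) = c2 * cone_phi C (velocity 0)"
  proof (rule exists_wolfe_step[of K C e c1 c2 "\<lambda>t. F (curve t)" velocity B])
    show "K \<noteq> {}" "C \<subseteq> dual_cone K"
      using assms(5,6) by auto
  qed (use assms neg B curve_in \<open>C \<noteq> {}\<close> has_vector_derivative_velocity continuous_on_velocity in auto)
  have "sufficient_decrease A R K C e c1 F x d t"
    using t(2) unfolding zero by (simp add: sufficient_decrease_def curve_def)
  moreover have "phi_slope A R C F x d t = c2 * cone_phi C (vector_differential A F x d)"
    using t(3) unfolding zero(2) by (simp add: phi_slope_def velocity_def curve_def)
  \<comment> \<open>Here \<open>0 < c1 < c2\<close> makes \<open>c2\<close> positive, so it can be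
    taken out of the absolute value.\<close>
  ultimately show ?thesis
    using t(1) assms(11,12)
    by (auto simp: wolfe_conditions_def strong_wolfe_conditions_def abs_mult)
qed

end
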